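(* Let $\varphi:\mathbb{R}\times\mathbb{R}\to\mathbb{R}$ be a covariance function that is symmetric in both its first and its second argument, and such that $\varphi(x,u)=0$ whenever $|x|\ge\pi$, for all $u\in\mathbb{R}$. Let $\psi:[0,\pi]\times\mathbb{R}\to\mathbb{R}$ be the restriction of $\varphi$ to the interval $[0,\pi]$ with respect to the first argument. Then $\psi$ is a geodesically isotropic and temporally symmetric covariance function on the circle $\mathbb{S}^1$ cross time $\mathbb{R}$.
   Context: That $\varphi:\mathbb{R}\times\mathbb{R}\to\mathbb{R}$ is a covariance function means that it is positive definite: $\sum_{i,j=1}^N c_i c_j\,\varphi(x_i-x_j,u_i-u_j)\ge 0$ for all $N\in\mathbb{N}$, all $(x_1,u_1),\dots,(x_N,u_N)\in\mathbb{R}\times\mathbb{R}$ and all $c_1,\dots,c_N\in\mathbb{R}$. Symmetric in both arguments means $\varphi(-x,u)=\varphi(x,u)$ and $\varphi(x,-u)=\varphi(x,u)$ for all $x,u\in\mathbb{R}$. $\mathbb{S}^1=\{s\in\mathbb{R}^2:\|s\|=1\}$ is the unit circle with geodesic (great circle) distance $d_{\mathrm{GC}}(s_1,s_2)=\arccos\langle s_1,s_2\rangle\in[0,\pi]$. A function $\psi:[0,\pi]\times\mathbb{R}\to\mathbb{R}$ is a geodesically isotropic and temporally symmetric covariance function on $\mathbb{S}^1\times\mathbb{R}$ if $((s_1,t_1),(s_2,t_2))\mapsto\psi(d_{\mathrm{GC}}(s_1,s_2),t_1-t_2)$ is a symmetric positive definite kernel on $\mathbb{S}^1\times\mathbb{R}$,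 i.e. $\sum_{i,j=1}^N c_i c_j\,\psi(d_{\mathrm{GC}}(s_i,s_j),t_i-t_j)\ge 0$ for all finite collections of points $(s_i,t_i)\in\mathbb{S}^1\times\mathbb{R}$ and reals $c_i$. *)

theory Defs
  imports "HOL-Analysis.Analysis"
begin

definition positive_definite_kernel_on :: "'a set \<Rightarrow> ('a \<Rightarrow> 'a \<Rightarrow> real) \<Rightarrow> bool" where
  "positive_definite_kernel_on A K \<longleftrightarrow>
    (\<forall>(N::nat) (p::nat \<Rightarrow> 'a) (c::nat \<Rightarrow> real). (\<forall>i\<in>{1..N}. p i \<in> A) \<longrightarrow>
      0 \<le> (\<Sum>i=1..N. \<Sum>j=1..N. c i * c j * K (p i) (p j)))"

definition symmetric_kernel_on :: "'a set \<Rightarrow> ('a \<Rightarrow> 'a \<Rightarrow> real) \<Rightarrow> bool" where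
  "symmetric_kernel_on A K \<longleftrightarrow> (\<forall>p\<in>A. \<forall>q\<in>A. K p q = K q p)"

definition covariance_function :: "(real \<times> real \<Rightarrow> real) \<Rightarrow> bool" where
  "covariance_function \<phi> \<longleftrightarrow>
    positive_definite_kernel_on UNIV (\<lambda>(x1, u1) (x2, u2). \<phi> (x1 - x2, u1 - u2))"

definition symmetric_in_both_arguments :: "(real \<times> real \<Rightarrow> real) \<Rightarrow> bool" where
  "symmetric_in_both_arguments \<phi> \<longleftrightarrow>
    (\<forall>x u. \<phi> (- x, u) = \<phi> (x, u)) \<and> (\<forall>x u. \<phi> (x, - u) = \<phi> (x, u))"

abbreviation unit_circle :: "(real ^ 2) set" where
  "unit_circle \<equiv> sphere 0 1"

definition great_circle_dist :: "real ^ 2 \<Rightarrow> real ^ 2 \<Rightarrow> real" where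
  "great_circle_dist s1 s2 = arccos (s1 \<bullet> s2)"

(* psi stands for a function on [0,pi] x R. Only its values there matter, because
   great_circle_dist takes values in [0,pi] on the unit circle. *)
definition circle_time_kernel ::
    "(real \<times> real \<Rightarrow> real) \<Rightarrow> (real ^ 2) \<times> real \<Rightarrow> (real ^ 2) \<times> real \<Rightarrow> real" where
  "circle_time_kernel \<psi> = (\<lambda>(s1, t1) (s2, t2). \<psi> (great_circle_dist s1 s2, t1 - t2))"

definition isotropic_symmetric_covariance_on_circle_time :: "(real \<times> real \<Rightarrow> real) \<Rightarrow> bool" where
  "isotropic_symmetric_covariance_on_circle_time \<psi> \<longleftrightarrow>
    symmetric_kernel_on (unit_circle \<times> UNIV) (circle_time_kernel \<psi>) \<and>
    positive_definite_kernel_on (unit_circle \<times> UNIV) (circle_time_kernel \<psi>)"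

end

theory Submission
  imports Defs
begin

text \<open>
  Points of the circle are written as angles in \<open>[0, 2 \<pi>)\<close>. Since \<open>\<phi>(\<cdot>, u)\<close> vanishes
  outside \<open>(-\<pi>, \<pi>)\<close>, its \<open>2 \<pi>\<close>-periodization \<open>\<Sum>\<^sub>m \<phi>(x + 2 \<pi> m, u)\<close> takes at a
  difference of two angles the value of \<open>\<phi>\<close> at their geodesic distance: the translates
  have disjoint supports, and \<open>\<phi>\<close> is even. So the claim is that periodization
  preserves positive definiteness (\<open>periodization_positive_definite\<close>).

  That is shown by averaging over more and more copies of the given points. For angles
  \<open>\<theta>\<^sub>i\<close>, times \<open>t\<^sub>i\<close> and weights \<open>c\<^sub>i\<close>, place the weight \<open>c\<^sub>i\<close> at each of the points
  \<open>(\<theta>\<^sub>i + 2 \<pi> k, t\<^sub>i)\<close>, \<open>0 \<le> k \<le> n\<close>, of the plane. The quadratic form of \<open>\<phi>\<close> at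
  these points is nonnegative. The shift by \<open>2 \<pi> m\<close> occurs in it for \<open>n + 1 - \<bar>m\<bar>\<close> pairs of
  copies, and only \<open>\<bar>m\<bar> \<le> 1\<close> contributes, so the form equals \<open>n A + D\<close>, where \<open>A\<close> is the
  quadratic form of the periodization and \<open>D\<close> does not depend on \<open>n\<close>
  (\<open>sum_differences_band\<close>). Letting \<open>n\<close> grow gives \<open>A \<ge> 0\<close>.
\<close>

lemma positive_definite_kernel_on_finite:
  fixes c :: "'i \<Rightarrow> real"
  assumes pd: "positive_definite_kernel_on A K"
    and fin: "finite I" and p: "\<And>i. i \<in> I \<Longrightarrow> p i \<in> A"
  shows "0 \<le> (\<Sum>i\<in>I. \<Sum>j\<in>I. c i * c j * K (p i) (p j))"
proof -
  obtain h where h: "bij_betw h {1..card I} I"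
    using fin finite_same_card_bij[of "{1..card I}" I] by auto
  have "\<forall>i\<in>{1..card I}. (p \<circ> h) i \<in> A"
    using h p by (auto simp: bij_betw_def)
  then have "0 \<le> (\<Sum>i=1..card I. \<Sum>j=1..card I.
      (c \<circ> h) i * (c \<circ> h) j * K ((p \<circ> h) i) ((p \<circ> h) j))"
    using pd unfolding positive_definite_kernel_on_def by blast
  also have "\<dots> = (\<Sum>i=1..card I. \<Sum>j\<in>I. c (h i) * c j * K (p (h i)) (p j))"
    by (intro sum.cong refl)
      (simp add: sum.reindex_bij_betw[OF h, symmetric])
  also have "\<dots> = (\<Sum>i\<in>I. \<Sum>j\<in>I. c i * c j * K (p i) (p j))"
    by (rule sum.reindex_bij_betw[OF h])
  finally show ?thesis .
qed

text \<open>
  Among the pairs of numbers in \<open>{0..n}\<close>, \<open>n + 1\<close> have difference \<open>0\<close> and \<open>n\<close> each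
  have difference \<open>1\<close> and \<open>-1\<close>. The sum is written so as to separate the part linear in \<open>n\<close>
  from the constant one.
\<close>

lemma sum_differences_band:
  fixes g :: "int \<Rightarrow> real"
  assumes g: "\<And>m. \<bar>m\<bar> \<ge> 2 \<Longrightarrow> g m = 0"
  shows "(\<Sum>k\<le>n. \<Sum>l\<le>n. g (int k - int l)) = real n * (g 0 + g 1 + g (-1)) + g 0"
proof (induction n)
  case 0
  show ?case by simp
next
  case (Suc n)
  have edge: "(\<Sum>k\<le>n. h (int (Suc n) - int k)) = h 1"
    if "\<And>m. \<bar>m\<bar> \<ge> 2 \<Longrightarrow> h m = 0" for h :: "int \<Rightarrow> real"
  proof -
    have "(\<Sum>k\<le>n. h (int (Suc n) - int k)) = (\<Sum>k\<in>{n}. h (int (Suc n) - int k))"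
      by (rule sum.mono_neutral_right) (auto intro!: that)
    then show ?thesis by simp
  qed
  have row: "(\<Sum>l\<le>n. g (int (Suc n) - int l)) = g 1"
    using g by (rule edge)
  have col: "(\<Sum>k\<le>n. g (int k - int (Suc n))) = g (-1)"
    using edge[of "\<lambda>m. g (- m)"] g by simp
  have "(\<Sum>k\<le>Suc n. \<Sum>l\<le>Suc n. g (int k - int l)) =
      (\<Sum>k\<le>n. \<Sum>l\<le>n. g (int k - int l)) + (\<Sum>k\<le>n. g (int k - int (Suc n)))
      + (\<Sum>l\<le>n. g (int (Suc n) - int l)) + g 0"
    by (simp add: sum.distrib)
  then show ?case
    unfolding row col Suc.IH by (simp add: algebra_simps)
qed

text \<open>
  Angles in \<open>[0, 2 \<pi>)\<close> differ by less than \<open>2 \<pi>\<close>, so for \<open>\<phi>\<close> supported in \<open>\<bar>x\<bar> < 2 \<pi>\<close>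
  the three terms below are the whole periodization.
\<close>

lemma periodization_positive_definite:
  fixes \<phi> :: "real \<times> real \<Rightarrow> real" and \<theta> t c :: "'i \<Rightarrow> real"
  assumes cov: "covariance_function \<phi>"
    and supp: "\<And>x u. \<bar>x\<bar> \<ge> 2 * pi \<Longrightarrow> \<phi> (x, u) = 0"
    and fin: "finite I"
    and \<theta>: "\<And>i. i \<in> I \<Longrightarrow> 0 \<le> \<theta> i \<and> \<theta> i < 2 * pi"
  shows "0 \<le> (\<Sum>i\<in>I. \<Sum>j\<in>I. c i * c j *
    (\<phi> (\<theta> i - \<theta> j, t i - t j) + \<phi> (\<theta> i - \<theta> j + 2 * pi, t i - t j)
      + \<phi> (\<theta> i - \<theta> j - 2 * pi, t i - t j)))"
    (is "0 \<le> ?A")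
proof -
  define D where "D = (\<Sum>i\<in>I. \<Sum>j\<in>I. c i * c j * \<phi> (\<theta> i - \<theta> j, t i - t j))"
  define g where "g i j m = \<phi> (\<theta> i - \<theta> j + 2 * pi * of_int m, t i - t j)" for i j m
  have g0: "g i j m = 0" if "i \<in> I" "j \<in> I" "\<bar>m\<bar> \<ge> 2" for i j and m :: int
  proof -
    have "2 * pi * 2 \<le> 2 * pi * \<bar>real_of_int m\<bar>"
      using that(3) by (intro mult_left_mono) auto
    then have "4 * pi \<le> \<bar>2 * pi * real_of_int m\<bar>"
      by (simp add: abs_mult)
    then have "\<bar>\<theta> i - \<theta> j + 2 * pi * of_int m\<bar> \<ge> 2 * pi"
      using \<theta>[OF that(1)] \<theta>[OF that(2)] by linarith
    then show ?thesis unfolding g_def by (rule supp)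
  qed
  have nonneg: "0 \<le> real n * ?A + D" for n
  proof -
    have "0 \<le> (\<Sum>a\<in>I \<times> {..n}. \<Sum>b\<in>I \<times> {..n}. c (fst a) * c (fst b) *
        (case (\<theta> (fst a) + 2 * pi * real (snd a), t (fst a)) of (x1, u1) \<Rightarrow> \<lambda>(x2, u2).
          \<phi> (x1 - x2, u1 - u2)) (\<theta> (fst b) + 2 * pi * real (snd b), t (fst b)))"
      by (rule positive_definite_kernel_on_finite
          [OF cov[unfolded covariance_function_def], where c = "\<lambda>a. c (fst a)"
            and p = "\<lambda>a. (\<theta> (fst a) + 2 * pi * real (snd a), t (fst a))"])
        (use fin in auto)
    also have "\<dots> = (\<Sum>a\<in>I \<times> {..n}. \<Sum>b\<in>I \<times> {..n}. c (fst a) * c (fst b) *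
        g (fst a) (fst b) (int (snd a) - int (snd b)))"
      by (intro sum.cong refl) (simp add: g_def algebra_simps)
    also have "\<dots> = (\<Sum>i\<in>I. \<Sum>k\<le>n. \<Sum>j\<in>I. \<Sum>l\<le>n. c i * c j * g i j (int k - int l))"
      by (simp add: sum.cartesian_product')
    also have "\<dots> = (\<Sum>i\<in>I. \<Sum>j\<in>I. c i * c j * (\<Sum>k\<le>n. \<Sum>l\<le>n. g i j (int k - int l)))"
      unfolding sum_distrib_left by (intro sum.cong refl sum.swap)
    also have "\<dots> = (\<Sum>i\<in>I. \<Sum>j\<in>I. c i * c j *
        (real n * (g i j 0 + g i j 1 + g i j (-1)) + g i j 0))"
      by (intro sum.cong refl arg_cong2[where f = "(*)"] sum_differences_band g0)
    also have "\<dots> = real n * ?A + D"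
      unfolding D_def g_def sum_distrib_left sum.distrib[symmetric]
      by (intro sum.cong refl) (simp add: algebra_simps)
    finally show ?thesis .
  qed
  show ?thesis
  proof (rule ccontr)
    assume "\<not> ?thesis"
    then have neg: "0 < - ?A" by simp
    obtain n where "D < real n * (- ?A)"
      using reals_Archimedean3[OF neg] by blast
    with nonneg[of n] show False by simp
  qed
qed

lemma unit_circle_angle:
  assumes "s \<in> unit_circle"
  obtains \<theta> where "0 \<le> \<theta>" "\<theta> < 2 * pi" "s $ 1 = cos \<theta>" "s $ 2 = sin \<theta>"
proof -
  have "s \<bullet> s = 1"
    using assms by (simp add: dot_square_norm)
  then have "(s $ 1)\<^sup>2 + (s $ 2)\<^sup>2 = 1"
    by (simp add: inner_vec_def sum_2 power2_eq_square)
  then show thesis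
    using sincos_total_2pi[of "s $ 1" "s $ 2"] that by metis
qed

lemma great_circle_dist_angles:
  assumes "s1 $ 1 = cos a" "s1 $ 2 = sin a" "s2 $ 1 = cos b" "s2 $ 2 = sin b"
    and "0 \<le> a" "a < 2 * pi" "0 \<le> b" "b < 2 * pi"
  shows "great_circle_dist s1 s2 = (if \<bar>a - b\<bar> \<le> pi then \<bar>a - b\<bar> else 2 * pi - \<bar>a - b\<bar>)"
proof -
  have dist: "great_circle_dist s1 s2 = arccos (cos \<bar>a - b\<bar>)"
    using assms by (simp add: great_circle_dist_def inner_vec_def sum_2 cos_diff)
  show ?thesis
  proof (cases "\<bar>a - b\<bar> \<le> pi")
    case True
    then show ?thesis by (simp add: dist arccos_cos del: cos_abs_real)
  next
    case False
    have "cos \<bar>a - b\<bar> = cos (2 * pi - \<bar>a - b\<bar>)"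
      by (simp add: cos_diff)
    moreover have "0 \<le> 2 * pi - \<bar>a - b\<bar>" "2 * pi - \<bar>a - b\<bar> \<le> pi"
      using assms False by linarith+
    ultimately have "arccos (cos \<bar>a - b\<bar>) = 2 * pi - \<bar>a - b\<bar>"
      by (simp only: arccos_cos)
    with False show ?thesis by (simp add: dist del: cos_abs_real)
  qed
qed

text \<open>
  At most one of the three translates is nonzero: the one that moves the difference of the
  angles into \<open>(-\<pi>, \<pi>)\<close>, where its absolute value is the geodesic distance. When that distance
  is \<open>\<pi>\<close>, all terms vanish.
\<close>

lemma periodization_eq_great_circle:
  fixes \<phi> :: "real \<times> real \<Rightarrow> real"
  assumes even: "\<And>x. \<phi> (- x, u) = \<phi> (x, u)"
    and supp: "\<And>x. \<bar>x\<bar> \<ge> pi \<Longrightarrow> \<phi> (x, u) = 0"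
    and angles: "s1 $ 1 = cos a" "s1 $ 2 = sin a" "s2 $ 1 = cos b" "s2 $ 2 = sin b"
    and bounds: "0 \<le> a" "a < 2 * pi" "0 \<le> b" "b < 2 * pi"
  shows "\<phi> (a - b, u) + \<phi> (a - b + 2 * pi, u) + \<phi> (a - b - 2 * pi, u)
    = \<phi> (great_circle_dist s1 s2, u)"
proof -
  have abs: "\<phi> (\<bar>x\<bar>, u) = \<phi> (x, u)" for x
    using even[of x] by (simp add: abs_if)
  consider "\<bar>a - b\<bar> \<le> pi" | "a - b > pi" | "a - b < - pi" by linarith
  then show ?thesis
  proof cases
    case 1
    then have "\<phi> (a - b + 2 * pi, u) = 0" "\<phi> (a - b - 2 * pi, u) = 0"
      by (auto intro!: supp)
    then show ?thesis
      using 1 by (simp add: great_circle_dist_angles[OF angles bounds] abs)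
  next
    case 2
    then have "\<phi> (a - b, u) = 0" "\<phi> (a - b + 2 * pi, u) = 0"
      by (auto intro!: supp)
    moreover have "\<bar>a - b\<bar> = a - b"
      using 2 pi_gt_zero by linarith
    with 2 have "great_circle_dist s1 s2 = - (a - b - 2 * pi)"
      by (simp add: great_circle_dist_angles[OF angles bounds])
    ultimately show ?thesis by (simp only: even)
  next
    case 3
    then have "\<phi> (a - b, u) = 0" "\<phi> (a - b - 2 * pi, u) = 0"
      by (auto intro!: supp)
    moreover have "\<bar>a - b\<bar> = - (a - b)"
      using 3 pi_gt_zero by linarith
    with 3 have "great_circle_dist s1 s2 = a - b + 2 * pi"
      by (simp add: great_circle_dist_angles[OF angles bounds])
    ultimately show ?thesis by simp
  qed
qed

lemma great_circle_dist_bounds: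
  assumes "s1 \<in> unit_circle" "s2 \<in> unit_circle"
  shows "great_circle_dist s1 s2 \<in> {0..pi}"
proof -
  have "\<bar>s1 \<bullet> s2\<bar> \<le> 1"
    using Cauchy_Schwarz_ineq2[of s1 s2] assms by simp
  then show ?thesis
    using arccos_bounded[of "s1 \<bullet> s2"] by (auto simp: great_circle_dist_def abs_le_iff)
qed

theorem theorem3p2:
  fixes \<phi> \<psi> :: "real \<times> real \<Rightarrow> real"
  assumes "covariance_function \<phi>"
    and "symmetric_in_both_arguments \<phi>"
    and "\<And>x u. \<bar>x\<bar> \<ge> pi \<Longrightarrow> \<phi> (x, u) = 0"
    and "\<psi> = restrict \<phi> ({0..pi} \<times> UNIV)"
  shows "isotropic_symmetric_covariance_on_circle_time \<psi>"
proof -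
  have even: "\<phi> (- x, u) = \<phi> (x, u)" "\<phi> (x, - u) = \<phi> (x, u)" for x u
    using assms(2) by (auto simp: symmetric_in_both_arguments_def)
  have kernel: "circle_time_kernel \<psi> p q =
      \<phi> (great_circle_dist (fst p) (fst q), snd p - snd q)"
    if "p \<in> unit_circle \<times> UNIV" "q \<in> unit_circle \<times> UNIV" for p q
    using great_circle_dist_bounds[of "fst p" "fst q"] that
    by (auto simp: circle_time_kernel_def assms(4))
  have "symmetric_kernel_on (unit_circle \<times> UNIV) (circle_time_kernel \<psi>)"
    unfolding symmetric_kernel_on_def
  proof (intro ballI)
    fix p q :: "(real ^ 2) \<times> real"
    assume pq: "p \<in> unit_circle \<times> UNIV" "q \<in> unit_circle \<times> UNIV"
    have "great_circle_dist (fst p) (fst q) = great_circle_dist (fst q) (fst p)"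
      by (simp add: great_circle_dist_def inner_commute)
    with even(2)[of _ "snd p - snd q"]
    show "circle_time_kernel \<psi> p q = circle_time_kernel \<psi> q p"
      unfolding kernel[OF pq] kernel[OF pq(2,1)] by simp
  qed
  moreover have "positive_definite_kernel_on (unit_circle \<times> UNIV) (circle_time_kernel \<psi>)"
    unfolding positive_definite_kernel_on_def
  proof (intro allI impI)
    fix N :: nat and p :: "nat \<Rightarrow> (real ^ 2) \<times> real" and c :: "nat \<Rightarrow> real"
    assume p: "\<forall>i\<in>{1..N}. p i \<in> unit_circle \<times> UNIV"
    have "\<forall>i\<in>{1..N}. \<exists>a. 0 \<le> a \<and> a < 2 * pi \<and>
        fst (p i) $ 1 = cos a \<and> fst (p i) $ 2 = sin a"
    proof
      fix i assume "i \<in> {1..N}"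
      with p have "fst (p i) \<in> unit_circle" by (auto simp: mem_Times_iff)
      then show "\<exists>a. 0 \<le> a \<and> a < 2 * pi \<and> fst (p i) $ 1 = cos a \<and> fst (p i) $ 2 = sin a"
        by (elim unit_circle_angle) blast
    qed
    from bchoice[OF this] obtain \<theta> where \<theta>: "\<And>i. i \<in> {1..N} \<Longrightarrow> 0 \<le> \<theta> i \<and> \<theta> i < 2 * pi \<and>
        fst (p i) $ 1 = cos (\<theta> i) \<and> fst (p i) $ 2 = sin (\<theta> i)"
      by blast
    define t where "t i = snd (p i)" for i
    have "0 \<le> (\<Sum>i=1..N. \<Sum>j=1..N. c i * c j *
      (\<phi> (\<theta> i - \<theta> j, t i - t j) + \<phi> (\<theta> i - \<theta> j + 2 * pi, t i - t j)
        + \<phi> (\<theta> i - \<theta> j - 2 * pi, t i - t j)))"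
    proof (rule periodization_positive_definite[OF assms(1)])
      show "\<phi> (x, u) = 0" if "\<bar>x\<bar> \<ge> 2 * pi" for x u
        using that pi_gt_zero by (intro assms(3)) linarith
    qed (use \<theta> in auto)
    also have "\<dots> = (\<Sum>i=1..N. \<Sum>j=1..N. c i * c j * circle_time_kernel \<psi> (p i) (p j))"
    proof (intro sum.cong refl arg_cong2[where f = "(*)"])
      fix i j assume ij: "i \<in> {1..N}" "j \<in> {1..N}"
      have "circle_time_kernel \<psi> (p i) (p j) =
          \<phi> (great_circle_dist (fst (p i)) (fst (p j)), t i - t j)"
        unfolding t_def using p ij by (intro kernel) auto
      moreover have "\<phi> (\<theta> i - \<theta> j, t i - t j) + \<phi> (\<theta> i - \<theta> j + 2 * pi, t i - t j)
          + \<phi> (\<theta> i - \<theta> j - 2 * pi, t i - t j)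
          = \<phi> (great_circle_dist (fst (p i)) (fst (p j)), t i - t j)"
        by (rule periodization_eq_great_circle[OF even(1) assms(3)])
          (use \<theta>[OF ij(1)] \<theta>[OF ij(2)] in auto)
      ultimately show "\<phi> (\<theta> i - \<theta> j, t i - t j) + \<phi> (\<theta> i - \<theta> j + 2 * pi, t i - t j)
          + \<phi> (\<theta> i - \<theta> j - 2 * pi, t i - t j) = circle_time_kernel \<psi> (p i) (p j)"
        by simp
    qed
    finally show "0 \<le> (\<Sum>i=1..N. \<Sum>j=1..N. c i * c j * circle_time_kernel \<psi> (p i) (p j))" .
  qed
  ultimately show ?thesis
    unfolding isotropic_symmetric_covariance_on_circle_time_def by blast
qed

end
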